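(* Let $\mathfrak{g}$ be a finite-dimensional algebra over a field $\Bbbk$ with a pair of compatible Lie brackets (that is, $\mathfrak{g}\in\mathrm{Lie}_2$) and let $\dim(\mathfrak{g})=m$. Then the growth rate of the universal enveloping associative algebra $U_{\mathrm{Lie}_2}(\mathfrak{g})$ equals $m+1$.
   Context: A pair of compatible Lie brackets on a $\Bbbk$-vector space $\mathfrak{g}$ (equivalently, $\mathfrak{g}\in\mathrm{Lie}_2$) consists of two bilinear operations $[\cdot,\cdot]_1,[\cdot,\cdot]_2$ such that $\alpha[\cdot,\cdot]_1+\beta[\cdot,\cdot]_2$ is a Lie bracket for all $\alpha,\beta\in\Bbbk$. The (operadic) universal enveloping associative algebra $U_{\mathrm{Lie}_2}(\mathfrak{g})$ of $\mathfrak{g}\in\mathrm{Lie}_2$ with linear basis $X$ is the unital associative algebra with generators $X\cup X'$, where $X'=\{x'\mid x\in X\}$ is disjoint from $X$ and $x\mapsto x'$ is a bijection, and defining relations $$xy-yx+[x,y]_1=0,\qquad x'y'-y'x'+([x,y]_2)'=0,\qquad xy'-y'x+x'y-yx'+([x,y]_1)'+[x,y]_2=0$$ for all $x,y\in X$ (with $'$ extended linearly to a map from $\mathfrak{g}$ to the span of $X'$). Let $X=\{f_1,\dots,f_m\}$ be a basis of $\mathfrak{g}$ and $X'=\{F_1,\dots,F_m\}$, $F_i=f_i'$. $M(X)$ is the set consisting of the empty word $1$ and all words $f_{j_1}\cdots f_{j_n}$, $n\ge1$, with $j_1\le\dots\le j_n$; for such a nonempty word $w$, $\lfloor w\rfloor=j_n$.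 $M(X')$ is the set consisting of the empty word $1$ and all words $F_{k_1}\cdots F_{k_l}$, $l\ge1$, with $k_l\le\dots\le k_1$; for such a nonempty word $u$, $\lceil u\rceil=k_l$. $L=M(X)\cup L'$, where $L'$ is the set of all words in the alphabet $X\cup X'$ of the form $w_0u_1w_1u_2w_2\cdots u_{s-1}w_{s-1}u_sw_s$, $s\ge1$, such that $w_i\in M(X)\setminus\{1\}$ for $i=1,\dots,s-1$; $w_0,w_s\in M(X)$; $u_i\in M(X')\setminus\{1\}$ for $i=1,\dots,s$; $\lfloor w_i\rfloor\le\lceil u_i\rceil$ for $i=1,\dots,s-1$; and either $w_s=1$ or $\lfloor w_s\rfloor\le\lceil u_s\rceil$. The set $L$ is a linear basis of $U_{\mathrm{Lie}_2}(\mathfrak{g})$. $L_n$ is the set of words in $L$ of length $n$ (number of letters), $r_n=|L_n|$, and the growth rate of $U_{\mathrm{Lie}_2}(\mathfrak{g})$ is defined as $\lim_{n\to\infty}\sqrt[n]{r_n}$. *)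

theory Defs
  imports Complex_Main "HOL-Library.Poly_Mapping" "HOL-Algebra.QuotRing" "HOL-Algebra.Module"
begin

section \<open>Compatible Lie brackets\<close>

definition is_bilinear :: "('k::field \<Rightarrow> 'g::ab_group_add \<Rightarrow> 'g) \<Rightarrow> ('g \<Rightarrow> 'g \<Rightarrow> 'g) \<Rightarrow> bool" where
  "is_bilinear scale br \<longleftrightarrow>
     (\<forall>x. Vector_Spaces.linear scale scale (\<lambda>y. br x y)) \<and>
     (\<forall>y. Vector_Spaces.linear scale scale (\<lambda>x. br x y))"

definition is_lie_bracket :: "('k::field \<Rightarrow> 'g::ab_group_add \<Rightarrow> 'g) \<Rightarrow> ('g \<Rightarrow> 'g \<Rightarrow> 'g) \<Rightarrow> bool" where
  "is_lie_bracket scale br \<longleftrightarrow>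
     is_bilinear scale br \<and>
     (\<forall>x. br x x = 0) \<and>
     (\<forall>x y z. br x (br y z) + br y (br z x) + br z (br x y) = 0)"

definition compatible_lie_brackets ::
    "('k::field \<Rightarrow> 'g::ab_group_add \<Rightarrow> 'g) \<Rightarrow> ('g \<Rightarrow> 'g \<Rightarrow> 'g) \<Rightarrow> ('g \<Rightarrow> 'g \<Rightarrow> 'g) \<Rightarrow> bool" where
  "compatible_lie_brackets scale br1 br2 \<longleftrightarrow>
     vector_space scale \<and> is_bilinear scale br1 \<and> is_bilinear scale br2 \<and>
     (\<forall>\<alpha> \<beta>. is_lie_bracket scale (\<lambda>x y. scale \<alpha> (br1 x y) + scale \<beta> (br2 x y)))"

definition ordered_basis :: "('k::field \<Rightarrow> 'g::ab_group_add \<Rightarrow> 'g) \<Rightarrow> nat \<Rightarrow> (nat \<Rightarrow> 'g) \<Rightarrow> bool" where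
  "ordered_basis scale m f \<longleftrightarrow>
     inj_on f {1..m} \<and>
     \<not> module.dependent scale (f ` {1..m}) \<and>
     module.span scale (f ` {1..m}) = UNIV"

section \<open>Free associative algebras\<close>

text \<open>Words form a monoid under concatenation, so that the type
  \<open>'a list \<Rightarrow>\<^sub>0 'k\<close> with the convolution product is the free unital associative
  algebra over \<open>'a\<close>.\<close>

instantiation list :: (type) monoid_add
begin
definition zero_list :: "'a list" where "zero_list = []"
definition plus_list :: "'a list \<Rightarrow> 'a list \<Rightarrow> 'a list" where "plus_list = append"
instance by standard (simp_all add: zero_list_def plus_list_def)
end

abbreviation monomial :: "'a list \<Rightarrow> 'a list \<Rightarrow>\<^sub>0 'k::field" where
  "monomial w \<equiv> Poly_Mapping.single w 1"

definition free_algebra :: "'a set \<Rightarrow> ('a list \<Rightarrow>\<^sub>0 'k::field) ring" where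
  "free_algebra A =
     \<lparr>carrier = {p. Poly_Mapping.keys p \<subseteq> lists A}, mult = (*), one = 1, zero = 0, add = (+)\<rparr>"

lemma free_algebra_ring: "ring (free_algebra A :: ('a list \<Rightarrow>\<^sub>0 'k::field) ring)"
proof (rule ringI)
  let ?F = "free_algebra A :: ('a list \<Rightarrow>\<^sub>0 'k) ring"
  show "abelian_group ?F"
  proof (rule abelian_groupI)
    fix x assume "x \<in> carrier ?F"
    then show "\<exists>y\<in>carrier ?F. y \<oplus>\<^bsub>?F\<^esub> x = \<zero>\<^bsub>?F\<^esub>"
      by (intro bexI[of _ "- x"]) (auto simp: free_algebra_def)
  next
    fix x y assume "x \<in> carrier ?F" "y \<in> carrier ?F"
    then show "x \<oplus>\<^bsub>?F\<^esub> y \<in> carrier ?F"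
      using keys_add[of x y] by (auto simp: free_algebra_def simp del: in_lists_conv_set)
  qed (simp_all add: free_algebra_def add_ac)
  show "monoid ?F"
  proof (rule monoidI)
    fix x y assume xy: "x \<in> carrier ?F" "y \<in> carrier ?F"
    then have "Poly_Mapping.keys (x * y) \<subseteq> lists A"
      using keys_mult[of x y] by (fastforce simp: free_algebra_def plus_list_def)
    then show "x \<otimes>\<^bsub>?F\<^esub> y \<in> carrier ?F" by (simp add: free_algebra_def)
  qed (auto simp: free_algebra_def mult.assoc zero_list_def)
qed (simp_all add: free_algebra_def algebra_simps)

section \<open>The universal enveloping algebra of a pair of compatible Lie brackets\<close>

text \<open>\<open>Unprimed i\<close> stands for the generator \<open>f\<^sub>i\<close>, and \<open>Primed i\<close> for \<open>F\<^sub>i = f\<^sub>i'\<close>.\<close>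

datatype letter = Unprimed nat | Primed nat

primrec letter_index :: "letter \<Rightarrow> nat" where
  "letter_index (Unprimed i) = i"
| "letter_index (Primed i) = i"

definition U_gens :: "nat \<Rightarrow> letter set" where
  "U_gens m = Unprimed ` {1..m} \<union> Primed ` {1..m}"

text \<open>The linear embedding of \<open>\<gg>\<close> into the free algebra that sends each \<open>f\<^sub>k\<close> to the letter
  \<open>c k\<close>; \<open>c\<close> is \<open>Unprimed\<close> for \<open>v \<mapsto> v\<close> and \<open>Primed\<close> for \<open>v \<mapsto> v'\<close>.\<close>

definition lin_embed :: "('k::field \<Rightarrow> 'g::ab_group_add \<Rightarrow> 'g) \<Rightarrow> nat \<Rightarrow> (nat \<Rightarrow> 'g) \<Rightarrow>
    (nat \<Rightarrow> letter) \<Rightarrow> 'g \<Rightarrow> letter list \<Rightarrow>\<^sub>0 'k" where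
  "lin_embed scale m f c v =
     (\<Sum>k\<in>{1..m}. Poly_Mapping.single [c k] (module.representation scale (f ` {1..m}) v (f k)))"

definition U_relations :: "('k::field \<Rightarrow> 'g::ab_group_add \<Rightarrow> 'g) \<Rightarrow> ('g \<Rightarrow> 'g \<Rightarrow> 'g) \<Rightarrow>
    ('g \<Rightarrow> 'g \<Rightarrow> 'g) \<Rightarrow> nat \<Rightarrow> (nat \<Rightarrow> 'g) \<Rightarrow> (letter list \<Rightarrow>\<^sub>0 'k) set" where
  "U_relations scale br1 br2 m f =
     (let x = (\<lambda>i. monomial [Unprimed i]); x' = (\<lambda>i. monomial [Primed i]);
          e = lin_embed scale m f Unprimed; e' = lin_embed scale m f Primed
      in (\<Union>i\<in>{1..m}. \<Union>j\<in>{1..m}.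
           {x i * x j - x j * x i + e (br1 (f i) (f j)),
            x' i * x' j - x' j * x' i + e' (br2 (f i) (f j)),
            x i * x' j - x' j * x i + x' i * x j - x j * x' i
              + e' (br1 (f i) (f j)) + e (br2 (f i) (f j))}))"

definition U_ideal :: "('k::field \<Rightarrow> 'g::ab_group_add \<Rightarrow> 'g) \<Rightarrow> ('g \<Rightarrow> 'g \<Rightarrow> 'g) \<Rightarrow>
    ('g \<Rightarrow> 'g \<Rightarrow> 'g) \<Rightarrow> nat \<Rightarrow> (nat \<Rightarrow> 'g) \<Rightarrow> (letter list \<Rightarrow>\<^sub>0 'k) set" where
  "U_ideal scale br1 br2 m f =
     genideal (free_algebra (U_gens m)) (U_relations scale br1 br2 m f)"

section \<open>The words of the linear basis\<close>

text \<open>\<open>M_unprimed m\<close> and \<open>M_primed m\<close> are \<open>M(X)\<close> and \<open>M(X')\<close>, the empty word included.  For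
  nonempty words of either kind, both \<open>\<lfloor>w\<rfloor>\<close> and \<open>\<lceil>u\<rceil>\<close> are the index of the last letter.\<close>

definition M_unprimed :: "nat \<Rightarrow> letter list set" where
  "M_unprimed m = {map Unprimed js | js. set js \<subseteq> {1..m} \<and> sorted_wrt (\<le>) js}"

definition M_primed :: "nat \<Rightarrow> letter list set" where
  "M_primed m = {map Primed ks | ks. set ks \<subseteq> {1..m} \<and> sorted_wrt (\<ge>) ks}"

definition last_index :: "letter list \<Rightarrow> nat" where
  "last_index w = letter_index (last w)"

definition L'_words :: "nat \<Rightarrow> letter list set" where
  "L'_words m =
     {w 0 @ concat (map (\<lambda>i. u i @ w i) [1..<Suc s]) | (s::nat) w u.
        1 \<le> s \<and>
        (\<forall>i\<in>{1..s-1}. w i \<in> M_unprimed m - {[]}) \<and>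
        w 0 \<in> M_unprimed m \<and> w s \<in> M_unprimed m \<and>
        (\<forall>i\<in>{1..s}. u i \<in> M_primed m - {[]}) \<and>
        (\<forall>i\<in>{1..s-1}. last_index (w i) \<le> last_index (u i)) \<and>
        (w s = [] \<or> last_index (w s) \<le> last_index (u s))}"

definition L_words :: "nat \<Rightarrow> letter list set" where
  "L_words m = M_unprimed m \<union> L'_words m"

section \<open>Algebras with a basis of words and their growth rate\<close>

text \<open>An associative algebra together with its generators and the words in these generators that
  serve as its linear basis.  The growth rate is by definition measured on the basis words.  The
  record only carries this set of words; that \<open>L_words m\<close> is indeed a linear basis of the quotient
  algebra below is a separate theorem.\<close>

record ('k, 'u, 'a) word_algebra = "('k, 'u) module" +
  gen :: "'a \<Rightarrow> 'u"
  basis_words :: "'a list set"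

definition U_Lie2 :: "('k::field \<Rightarrow> 'g::ab_group_add \<Rightarrow> 'g) \<Rightarrow> ('g \<Rightarrow> 'g \<Rightarrow> 'g) \<Rightarrow>
    ('g \<Rightarrow> 'g \<Rightarrow> 'g) \<Rightarrow> nat \<Rightarrow> (nat \<Rightarrow> 'g) \<Rightarrow>
    ('k, (letter list \<Rightarrow>\<^sub>0 'k) set, letter) word_algebra" where
  "U_Lie2 scale br1 br2 m f =
     (let F = free_algebra (U_gens m); I = U_ideal scale br1 br2 m f; Q = F Quot I
      in \<lparr>carrier = carrier Q, mult = mult Q, one = one Q, zero = zero Q, add = add Q,
          smult = (\<lambda>c S. (I +>\<^bsub>F\<^esub> Poly_Mapping.single [] c) \<otimes>\<^bsub>Q\<^esub> S),
          gen = (\<lambda>a. I +>\<^bsub>F\<^esub> monomial [a]),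
          basis_words = L_words m\<rparr>)"

text \<open>The set of basis words of length \<open>n\<close> and its cardinality \<open>r\<^sub>n\<close>.\<close>

definition basis_words_of_length :: "('k, 'u, 'a) word_algebra \<Rightarrow> nat \<Rightarrow> 'a list set" where
  "basis_words_of_length U n = {w \<in> basis_words U. length w = n}"

definition has_growth_rate :: "('k, 'u, 'a) word_algebra \<Rightarrow> real \<Rightarrow> bool" where
  "has_growth_rate U c \<longleftrightarrow>
     (\<lambda>n. root n (real (card (basis_words_of_length U n)))) \<longlonglongrightarrow> c"

section \<open>The enveloping algebra is a ring in which the defining relations hold\<close>

lemma lin_embed_in_free_algebra:
  fixes scale :: "'k::field \<Rightarrow> 'g::ab_group_add \<Rightarrow> 'g" and A :: "letter set"
  assumes "c ` {1..m} \<subseteq> A"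
  shows "Poly_Mapping.keys (lin_embed scale m f c v) \<subseteq> lists A"
proof -
  have sum: "Poly_Mapping.keys (\<Sum>k\<in>K. p k) \<subseteq> lists A"
    if "\<And>k. k \<in> K \<Longrightarrow> Poly_Mapping.keys (p k) \<subseteq> lists A"
    for K and p :: "nat \<Rightarrow> letter list \<Rightarrow>\<^sub>0 'k"
    using that
  proof (induction K rule: infinite_finite_induct)
    case (insert k K)
    then have "Poly_Mapping.keys (p k) \<union> Poly_Mapping.keys (sum p K) \<subseteq> lists A"
      by (meson Un_least insertCI)
    then show ?case
      using keys_add[of "p k" "sum p K"] insert.hyps by (metis order_trans sum.insert)
  qed simp_all
  have "Poly_Mapping.keys (Poly_Mapping.single [c k] a) \<subseteq> lists A"
    if "k \<in> {1..m}" for k and a :: 'k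
    using assms that by (simp add: image_subset_iff)
  then show ?thesis
    unfolding lin_embed_def by (rule sum)
qed

lemma U_relations_subset:
  fixes scale :: "'k::field \<Rightarrow> 'g::ab_group_add \<Rightarrow> 'g"
  shows "U_relations scale br1 br2 m f \<subseteq> carrier (free_algebra (U_gens m))"
proof -
  let ?L = "lists (U_gens m)"
  have add: "Poly_Mapping.keys (p + q) \<subseteq> ?L"
    if "Poly_Mapping.keys p \<subseteq> ?L" "Poly_Mapping.keys q \<subseteq> ?L" for p q :: "letter list \<Rightarrow>\<^sub>0 'k"
    by (rule order_trans[OF keys_add Un_least[OF that]])
  have diff: "Poly_Mapping.keys (p - q) \<subseteq> ?L"
    if "Poly_Mapping.keys p \<subseteq> ?L" "Poly_Mapping.keys q \<subseteq> ?L" for p q :: "letter list \<Rightarrow>\<^sub>0 'k"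
    by (rule order_trans[OF keys_diff Un_least[OF that]])
  have mon: "Poly_Mapping.keys (monomial [a] * monomial [b] :: letter list \<Rightarrow>\<^sub>0 'k) \<subseteq> ?L"
    if "a \<in> U_gens m" "b \<in> U_gens m" for a b
    using that by (simp add: mult_single plus_list_def)
  have gens: "Unprimed i \<in> U_gens m" "Primed i \<in> U_gens m" if "i \<in> {1..m}" for i
    using that by (auto simp: U_gens_def)
  have emb: "Poly_Mapping.keys (lin_embed scale m f Unprimed v) \<subseteq> ?L"
    "Poly_Mapping.keys (lin_embed scale m f Primed v) \<subseteq> ?L" for v
    by (intro lin_embed_in_free_algebra; simp add: U_gens_def)+
  have "Poly_Mapping.keys p \<subseteq> ?L" if "p \<in> U_relations scale br1 br2 m f" for p
  proof -
    from that obtain i j where ij: "i \<in> {1..m}" "j \<in> {1..m}"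
      and p: "p \<in> {monomial [Unprimed i] * monomial [Unprimed j]
          - monomial [Unprimed j] * monomial [Unprimed i]
          + lin_embed scale m f Unprimed (br1 (f i) (f j)),
        monomial [Primed i] * monomial [Primed j] - monomial [Primed j] * monomial [Primed i]
          + lin_embed scale m f Primed (br2 (f i) (f j)),
        monomial [Unprimed i] * monomial [Primed j] - monomial [Primed j] * monomial [Unprimed i]
          + monomial [Primed i] * monomial [Unprimed j]
          - monomial [Unprimed j] * monomial [Primed i]
          + lin_embed scale m f Primed (br1 (f i) (f j))
          + lin_embed scale m f Unprimed (br2 (f i) (f j))}"
      unfolding U_relations_def Let_def by (elim UN_E)
    note g = gens[OF ij(1)] gens[OF ij(2)]
    from p show ?thesis
    proof (elim insertE emptyE)
    qed (simp_all only:, (rule add diff mon emb g)+)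
  qed
  then show ?thesis by (auto simp: free_algebra_def)
qed

lemma U_ideal_ideal:
  "ideal (U_ideal scale br1 br2 m f) (free_algebra (U_gens m))"
  unfolding U_ideal_def
  by (intro ring.genideal_ideal free_algebra_ring U_relations_subset)

lemma U_quotient_ring:
  "ring (free_algebra (U_gens m) Quot U_ideal scale br1 br2 m f)"
  by (intro ideal.quotient_is_ring U_ideal_ideal)

lemma U_relations_in_ideal:
  "U_relations scale br1 br2 m f \<subseteq> U_ideal scale br1 br2 m f"
  unfolding U_ideal_def
  by (intro ring.genideal_self free_algebra_ring U_relations_subset)

end

theory Submission
  imports Defs
begin

text \<open>The words of \<open>L\<close> are the words accepted by a finite automaton, whose states
  \<open>(p, lo, hi)\<close> record that the next letter may be \<open>Primed k\<close> with \<open>k \<in> {1..p}\<close> or \<open>Unprimed j\<close>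
  with \<open>j \<in> {lo..hi}\<close>.  The transfer matrix of this automaton has the positive eigenvector
  \<open>q\<^sup>d + (p / m - 1) q\<^sup>p\<close>, where \<open>d = hi + 1 - lo\<close> and \<open>q = (m + 1) / m\<close>, for the eigenvalue
  \<open>m + 1\<close>.  Hence the number of words of length \<open>n\<close> lies between constant multiples of
  \<open>(m + 1)\<^sup>n\<close>.\<close>

fun accepts :: "nat \<Rightarrow> nat \<Rightarrow> nat \<Rightarrow> nat \<Rightarrow> letter list \<Rightarrow> bool" where
  "accepts m p lo hi [] \<longleftrightarrow> True"
| "accepts m p lo hi (Unprimed j # w) \<longleftrightarrow> j \<in> {lo..hi} \<and> accepts m m j hi w"
| "accepts m p lo hi (Primed k # w) \<longleftrightarrow> k \<in> {1..p} \<and> accepts m k 1 k w"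

section \<open>Words as sequences of blocks\<close>

text \<open>The pair \<open>(ks, js)\<close> holds the indices of one factor u_i w_i of a word in
  L'; \<open>js\<close> may be empty, as w_s may.\<close>

definition block :: "nat \<Rightarrow> nat list \<times> nat list \<Rightarrow> bool" where
  "block m = (\<lambda>(ks, js). ks \<noteq> [] \<and> set ks \<subseteq> {1..m} \<and> sorted_wrt (\<ge>) ks \<and>
     sorted js \<and> set js \<subseteq> {1..last ks})"

text \<open>Only the last factor may lack unprimed letters, since w_i is nonempty for i < s.\<close>

fun blocks :: "nat \<Rightarrow> (nat list \<times> nat list) list \<Rightarrow> bool" where
  "blocks m [] \<longleftrightarrow> True"
| "blocks m (b # bs) \<longleftrightarrow> block m b \<and> (snd b = [] \<longrightarrow> bs = []) \<and> blocks m bs"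

definition block_word :: "nat list \<times> nat list \<Rightarrow> letter list" where
  "block_word = (\<lambda>(ks, js). map Primed ks @ map Unprimed js)"

lemma blocks_conv_nth:
  "blocks m bs \<longleftrightarrow>
     (\<forall>i<length bs. block m (bs ! i) \<and> (Suc i < length bs \<longrightarrow> snd (bs ! i) \<noteq> []))"
  by (induction bs) (auto simp: All_less_Suc2)

lemma sorted_last_bound:
  assumes "sorted xs" "x \<in> set xs"
  shows "x \<le> last xs"
  using assms by (induction xs) auto

text \<open>An ascending \<open>js\<close> has its greatest entry last, so a bound on all of
  \<open>js\<close> amounts to one on its last entry; \<open>last ks\<close> is itself at most
  \<open>m\<close>.\<close>

lemma block_iff_letters:
  "block m (ks, js) \<longleftrightarrow> map Primed ks \<in> M_primed m - {[]} \<and> map Unprimed js \<in> M_unprimed m \<and>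
     (map Unprimed js = [] \<or> last_index (map Unprimed js) \<le> last_index (map Primed ks))"
proof -
  have inj: "inj Primed" "inj Unprimed"
    by (auto intro: injI)
  have "map Primed ks \<in> M_primed m \<longleftrightarrow> set ks \<subseteq> {1..m} \<and> sorted_wrt (\<ge>) ks"
    "map Unprimed js \<in> M_unprimed m \<longleftrightarrow> set js \<subseteq> {1..m} \<and> sorted js"
    by (auto simp: M_primed_def M_unprimed_def inj_map_eq_map[OF inj(1)] inj_map_eq_map[OF inj(2)])
  moreover have "set js \<subseteq> {1..last ks} \<longleftrightarrow> set js \<subseteq> {1..m} \<and> (js = [] \<or> last js \<le> last ks)"
    if "sorted js" "ks \<noteq> []" "set ks \<subseteq> {1..m}"
  proof -
    have "last ks \<le> m"
      using that last_in_set by fastforce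
    moreover have "set js \<subseteq> {1..last ks} \<Longrightarrow> js \<noteq> [] \<Longrightarrow> last js \<le> last ks"
      using last_in_set by fastforce
    ultimately show ?thesis
      using sorted_last_bound[OF that(1)] by fastforce
  qed
  ultimately show ?thesis
    by (cases "js = []") (auto simp: block_def last_index_def last_map del: subsetI)
qed

text \<open>The prefix \<open>js\<close> is w_0, and M(X) is the case without blocks.\<close>

lemma L_words_eq_blocks:
  "L_words m = {map Unprimed js @ concat (map block_word bs) | js bs.
     sorted js \<and> set js \<subseteq> {1..m} \<and> blocks m bs}" (is "_ = ?R")
proof (intro equalityI subsetI)
  fix v assume "v \<in> L_words m"
  then consider "v \<in> M_unprimed m" | "v \<in> L'_words m"
    by (auto simp: L_words_def)
  then show "v \<in> ?R"
  proof cases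
    case 1
    then obtain js where "v = map Unprimed js @ concat (map block_word [])" "sorted js"
      "set js \<subseteq> {1..m}" "blocks m []"
      by (auto simp: M_unprimed_def)
    then show ?thesis by blast
  next
    case 2
    then obtain s w u where s: "1 \<le> s"
      and v: "v = w 0 @ concat (map (\<lambda>i. u i @ w i) [1..<Suc s])"
      and w: "\<And>i. i \<in> {1..s-1} \<Longrightarrow> w i \<in> M_unprimed m - {[]}"
        "w 0 \<in> M_unprimed m" "w s \<in> M_unprimed m"
      and u: "\<And>i. i \<in> {1..s} \<Longrightarrow> u i \<in> M_primed m - {[]}"
      and last: "\<And>i. i \<in> {1..s-1} \<Longrightarrow> last_index (w i) \<le> last_index (u i)"
        "w s = [] \<or> last_index (w s) \<le> last_index (u s)"
      unfolding L'_words_def by blast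
    define ks js where "ks i = map letter_index (u i)" and "js i = map letter_index (w i)" for i
    have wM: "w i \<in> M_unprimed m" if "i \<le> s" for i
      using that w by (cases "i = 0 \<or> i = s") auto
    have wi: "w i = map Unprimed (js i)" if "i \<le> s" for i
      using wM[OF that] by (auto simp: M_unprimed_def js_def)
    have ui: "u i = map Primed (ks i)" if "i \<in> {1..s}" for i
      using u[OF that] by (auto simp: M_primed_def ks_def)
    have bl: "block m (ks i, js i)" if "i \<in> {1..s}" for i
    proof -
      have "w i = [] \<or> last_index (w i) \<le> last_index (u i)"
        using that last by (cases "i = s") auto
      then show ?thesis
        using that u[OF that] wM[of i] wi[of i] ui[OF that] by (simp add: block_iff_letters)
    qed
    define bs where "bs = map (\<lambda>i. (ks i, js i)) [1..<Suc s]"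
    have "blocks m bs"
      unfolding blocks_conv_nth
    proof (intro allI impI conjI)
      fix i assume i: "i < length bs"
      then show "block m (bs ! i)"
        using bl[of "Suc i"] by (simp add: bs_def del: upt_Suc)
      assume "Suc i < length bs"
      then show "snd (bs ! i) \<noteq> []"
        using w(1)[of "Suc i"] wi[of "Suc i"] by (auto simp: bs_def simp del: upt_Suc)
    qed
    moreover obtain js' where js': "w 0 = map Unprimed js'" "sorted js'" "set js' \<subseteq> {1..m}"
      using w(2) by (auto simp: M_unprimed_def)
    moreover have "js 0 = js'"
      using js'(1) by (simp add: js_def comp_def)
    moreover have "map (\<lambda>i. u i @ w i) [1..<Suc s] = map block_word bs"
      using wi ui by (auto simp: bs_def block_word_def simp del: upt_Suc)
    then have "v = map Unprimed (js 0) @ concat (map block_word bs)"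
      using v wi[of 0] by simp
    ultimately show ?thesis by blast
  qed
next
  fix v assume "v \<in> ?R"
  then obtain js bs where v: "v = map Unprimed js @ concat (map block_word bs)"
    and js: "sorted js" "set js \<subseteq> {1..m}" and bs: "blocks m bs"
    by blast
  have jsM: "map Unprimed js \<in> M_unprimed m"
    using js by (auto simp: M_unprimed_def)
  show "v \<in> L_words m"
  proof (cases "bs = []")
    case True
    then show ?thesis using v jsM by (simp add: L_words_def)
  next
    case False
    define s where "s = length bs"
    \<comment> \<open>Lists count from 0 while the factors u_i w_i count from 1, hence
      \<open>i - 1\<close>; w_0 is the separate prefix \<open>js\<close>, and \<open>u 0\<close> is
      a mere default.\<close>
    define u where "u i = map Primed (fst (bs ! (i - 1)))" for i
    define w where "w i = map Unprimed (if i = 0 then js else snd (bs ! (i - 1)))" for i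
    have "map block_word bs = map (\<lambda>i. u i @ w i) [1..<Suc s]"
      by (rule nth_equalityI)
        (auto simp: s_def u_def w_def block_word_def case_prod_beta simp del: upt_Suc)
    then have "v = w 0 @ concat (map (\<lambda>i. u i @ w i) [1..<Suc s])"
      using v by (simp add: w_def del: upt_Suc)
    moreover have bl: "u i \<in> M_primed m - {[]} \<and> w i \<in> M_unprimed m \<and>
        (w i = [] \<or> last_index (w i) \<le> last_index (u i))" if "i \<in> {1..s}" for i
    proof -
      have "i - 1 < length bs"
        using that by (auto simp: s_def)
      then have "block m (fst (bs ! (i - 1)), snd (bs ! (i - 1)))"
        using bs unfolding blocks_conv_nth by simp
      then show ?thesis
        using that unfolding block_iff_letters u_def w_def by auto
    qed
    moreover have "w i \<in> M_unprimed m \<and> w i \<noteq> [] \<and> last_index (w i) \<le> last_index (u i)"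
      if i: "i \<in> {1..s-1}" for i
    proof -
      have "w i \<noteq> []"
        using bs i unfolding blocks_conv_nth s_def w_def by (auto dest!: spec[of _ "i - 1"])
      then show ?thesis
        using bl[of i] i by auto
    qed
    moreover have "1 \<le> s"
      using False by (cases bs) (auto simp: s_def)
    moreover have "w 0 \<in> M_unprimed m"
      using jsM by (simp add: w_def)
    ultimately have "v \<in> L'_words m"
      unfolding L'_words_def mem_Collect_eq
      by - (rule exI[of _ s], rule exI[of _ w], rule exI[of _ u], simp del: upt_Suc)
    then show ?thesis by (simp add: L_words_def)
  qed
qed

section \<open>The automaton\<close>

text \<open>Each letter raises the lower end of the range to its own index and resets
  \<open>p\<close> to \<open>m\<close>, while \<open>hi\<close> stays.\<close>

lemma accepts_map_Unprimed:
  assumes "sorted js" "set js \<subseteq> {lo..hi}"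
  shows "accepts m p lo hi (map Unprimed js @ v) \<longleftrightarrow>
    (if js = [] then accepts m p lo hi v else accepts m m (last js) hi v)"
  using assms by (induction js arbitrary: p lo) (fastforce split: if_splits)+

text \<open>Each letter overwrites the whole state, which therefore depends on the last letter
  only.\<close>

lemma accepts_map_Primed:
  assumes "sorted_wrt (\<ge>) ks" "set ks \<subseteq> {1..p}"
  shows "accepts m p lo hi (map Primed ks @ v) \<longleftrightarrow>
    (if ks = [] then accepts m p lo hi v else accepts m (last ks) 1 (last ks) v)"
  using assms by (induction ks arbitrary: p lo hi) (fastforce split: if_splits)+

text \<open>A block may start with any primed letter, so it needs a state with \<open>p = m\<close>.
  Unprimed letters restore this state, and a block without them is the last one.\<close>

lemma blocks_accepted:
  assumes "blocks m bs"
  shows "accepts m m lo hi (concat (map block_word bs))"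
  using assms
proof (induction bs arbitrary: lo hi)
  case (Cons b bs)
  obtain ks js where b: "b = (ks, js)" by (cases b)
  show ?case
  proof (cases "js = []")
    case True
    then show ?thesis
      using Cons.prems accepts_map_Primed[of ks m m lo hi "[]"]
      by (auto simp: b block_def block_word_def)
  next
    case False
    then show ?thesis
      using Cons by (auto simp: b block_def block_word_def accepts_map_Primed accepts_map_Unprimed)
  qed
qed simp

text \<open>The incomplete first block \<open>(ks, js)\<close> absorbs the letters read by the induction; the
  condition linking \<open>js\<close> and \<open>bs\<close> makes the decomposition maximal.\<close>

lemma accepted_decomposition:
  assumes "accepts m p lo hi v" "p \<le> m"
  shows "\<exists>ks js bs. v = map Primed ks @ map Unprimed js @ concat (map block_word bs) \<and>
    sorted_wrt (\<ge>) ks \<and> set ks \<subseteq> {1..p} \<and> sorted js \<and>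
    set js \<subseteq> (if ks = [] then {lo..hi} else {1..last ks}) \<and>
    (js = [] \<longrightarrow> bs = []) \<and> blocks m bs"
  using assms
proof (induction m p lo hi v rule: accepts.induct)
  case (1 m p lo hi)
  show ?case by (intro exI[of _ "[]"]) simp
next
  case (2 m p lo hi j w)
  then obtain ks js bs where IH: "w = map Primed ks @ map Unprimed js @ concat (map block_word bs)"
    "sorted_wrt (\<ge>) ks" "set ks \<subseteq> {1..m}" "sorted js"
    "set js \<subseteq> (if ks = [] then {j..hi} else {1..last ks})"
    "js = [] \<longrightarrow> bs = []" "blocks m bs" and j: "j \<in> {lo..hi}"
    by auto
  show ?case
  proof (cases "ks = []")
    case True
    then show ?thesis
      using IH j by (intro exI[of _ "[]"] exI[of _ "j # js"] exI[of _ bs]) auto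
  next
    case False
    \<comment> \<open>The letter j is followed by a primed run, so the incomplete block is in fact
      complete: it moves to the front of \<open>bs\<close>, and \<open>[j]\<close> is an ascending
      run of its own before it.\<close>
    then show ?thesis
      using IH j
      by (intro exI[of _ "[]"] exI[of _ "[j]"] exI[of _ "(ks, js) # bs"])
        (auto simp: block_word_def block_def)
  qed
next
  case (3 m p lo hi k w)
  then obtain ks js bs where IH: "w = map Primed ks @ map Unprimed js @ concat (map block_word bs)"
    "sorted_wrt (\<ge>) ks" "set ks \<subseteq> {1..k}" "sorted js"
    "set js \<subseteq> (if ks = [] then {1..k} else {1..last ks})"
    "js = [] \<longrightarrow> bs = []" "blocks m bs" and k: "k \<in> {1..p}"
    by auto
  then show ?case
    by (intro exI[of _ "k # ks"] exI[of _ js] exI[of _ bs]) (auto split: if_splits)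
qed

lemma L_words_eq_accepted: "L_words m = {v. accepts m m 1 m v}"
proof (intro equalityI subsetI CollectI)
  fix v assume "v \<in> L_words m"
  then show "accepts m m 1 m v"
    unfolding L_words_eq_blocks by (auto simp: accepts_map_Unprimed blocks_accepted)
next
  fix v assume "v \<in> {v. accepts m m 1 m v}"
  then obtain ks js bs where v: "v = map Primed ks @ map Unprimed js @ concat (map block_word bs)"
    "sorted_wrt (\<ge>) ks" "set ks \<subseteq> {1..m}" "sorted js"
    "set js \<subseteq> (if ks = [] then {1..m} else {1..last ks})"
    "js = [] \<longrightarrow> bs = []" "blocks m bs"
    using accepted_decomposition[of m m 1 m v] by auto
  show "v \<in> L_words m"
  proof (cases "ks = []")
    case True
    then show ?thesis
      unfolding L_words_eq_blocks using v by auto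
  next
    case False
    \<comment> \<open>The word starts with a primed letter: w_0 is empty and the incomplete block is
      the first factor.\<close>
    then have "v = map Unprimed [] @ concat (map block_word ((ks, js) # bs))"
      "blocks m ((ks, js) # bs)"
      using v by (auto simp: block_word_def block_def)
    moreover have "sorted ([] :: nat list)" "set ([] :: nat list) \<subseteq> {1..m}" by simp_all
    ultimately show ?thesis
      unfolding L_words_eq_blocks by blast
  qed
qed

section \<open>Counting accepted words\<close>

definition accepted :: "nat \<Rightarrow> nat \<Rightarrow> nat \<Rightarrow> nat \<Rightarrow> nat \<Rightarrow> letter list set" where
  "accepted m n p lo hi = {v. accepts m p lo hi v \<and> length v = n}"

lemma accepted_0: "accepted m 0 p lo hi = {[]}"
  by (auto simp: accepted_def)

lemma accepted_Suc:
  "accepted m (Suc n) p lo hi =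
     (\<Union>j\<in>{lo..hi}. (#) (Unprimed j) ` accepted m n m j hi) \<union>
     (\<Union>k\<in>{1..p}. (#) (Primed k) ` accepted m n k 1 k)" (is "?L = ?R")
proof (rule Set.set_eqI)
  fix v show "v \<in> ?L \<longleftrightarrow> v \<in> ?R"
  proof (cases v)
    case (Cons a w)
    then show ?thesis by (cases a) (auto simp: accepted_def)
  qed (auto simp: accepted_def)
qed

lemma finite_accepted: "finite (accepted m n p lo hi)"
  by (induction n arbitrary: p lo hi) (simp_all add: accepted_0 accepted_Suc)

text \<open>Words with different first letters differ, so the unions are disjoint. The recursion is
  the action of the transfer matrix.\<close>

lemma card_accepted_Suc:
  "card (accepted m (Suc n) p lo hi) =
     (\<Sum>j\<in>{lo..hi}. card (accepted m n m j hi)) + (\<Sum>k\<in>{1..p}. card (accepted m n k 1 k))"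
  unfolding accepted_Suc
  by (subst card_Un_disjoint)
    (auto simp: finite_accepted card_UN_disjoint card_image intro!: arg_cong2[of _ _ _ _ "(+)"]
       card_UN_disjoint[THEN trans])

section \<open>A positive eigenvector of the transfer matrix\<close>

definition weight :: "nat \<Rightarrow> nat \<Rightarrow> nat \<Rightarrow> real" where
  "weight m p d = (1 + 1 / m) ^ d + (p / m - 1) * (1 + 1 / m) ^ p"

lemma weight_full: "m \<ge> 1 \<Longrightarrow> weight m m d = (1 + 1 / m) ^ d"
  by (simp add: weight_def)

lemma weight_diagonal: "weight m k k = k / m * (1 + 1 / m) ^ k"
  by (simp add: weight_def algebra_simps)

text \<open>This is the geometric sum q + ... + q^d with \<open>d = Suc hi - lo\<close>, where q /
  (q - 1) = m + 1 for q = 1 + 1/m.\<close>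

lemma sum_weight_full:
  assumes m: "m \<ge> 1" and "lo \<le> Suc hi"
  shows "(\<Sum>j\<in>{lo..hi}. weight m m (Suc hi - j)) = (real m + 1) * ((1 + 1 / m) ^ (Suc hi - lo) - 1)"
proof -
  let ?q = "1 + 1 / real m"
  have "(\<Sum>j\<in>{lo..<lo + d}. ?q ^ (lo + d - j)) = (real m + 1) * (?q ^ d - 1)" for d
  proof (induction d)
    case (Suc d)
    have "(\<Sum>j\<in>{lo..<lo + Suc d}. ?q ^ (lo + Suc d - j))
        = (\<Sum>j\<in>{lo..<lo + d}. ?q * ?q ^ (lo + d - j)) + ?q"
      by (simp add: Suc_diff_le)
    also have "\<dots> = ?q * ((real m + 1) * (?q ^ d - 1)) + ?q"
      by (simp only: sum_distrib_left[symmetric] Suc.IH)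
    also have "\<dots> = (real m + 1) * (?q ^ Suc d - 1)"
      using m by (simp add: field_simps)
    finally show ?case .
  qed simp
  from this[of "Suc hi - lo"] show ?thesis
    using assms by (simp add: weight_full atLeastLessThanSuc_atLeastAtMost)
qed

text \<open>The sum telescopes: with g(k) = (k/m - 1) q^k, the term (k/m) q^k is (m + 1) (g(k) - g(k
  - 1)), and g(0) = -1.\<close>

lemma sum_weight_diagonal:
  assumes m: "m \<ge> 1"
  shows "(\<Sum>k\<in>{1..p}. weight m k k) = (real m + 1) * ((p / m - 1) * (1 + 1 / m) ^ p + 1)"
proof (induction p)
  case (Suc p)
  have "(\<Sum>k\<in>{1..Suc p}. weight m k k)
      = (real m + 1) * ((p / m - 1) * (1 + 1 / m) ^ p + 1) + Suc p / m * (1 + 1 / m) ^ Suc p"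
    using Suc.IH by (simp add: weight_diagonal[of m "Suc p"])
  also have "\<dots> = (real m + 1) * ((Suc p / m - 1) * (1 + 1 / m) ^ Suc p + 1)"
  proof -
    \<comment> \<open>The power of q becomes an atom \<open>Q\<close>, which leaves a rational
      identity.\<close>
    have "(M + 1) * ((P / M - 1) * Q + 1) + (1 + P) / M * ((1 + 1 / M) * Q)
        = (M + 1) * (((1 + P) / M - 1) * ((1 + 1 / M) * Q) + 1)" if "M > 0" for M P Q :: real
      using that by (simp add: field_simps)
    from this[of m p "(1 + 1 / m) ^ p"] show ?thesis
      using m by simp
  qed
  finally show ?case .
qed simp

text \<open>The constants -(m + 1) and m + 1 left over by the two sums cancel.\<close>

lemma weight_eigenvector:
  assumes "m \<ge> 1" "lo \<le> Suc hi"
  shows "(\<Sum>j\<in>{lo..hi}. weight m m (Suc hi - j)) + (\<Sum>k\<in>{1..p}. weight m k k)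
    = (real m + 1) * weight m p (Suc hi - lo)"
  unfolding sum_weight_full[OF assms] sum_weight_diagonal[OF assms(1)]
  by (simp add: weight_def algebra_simps)

text \<open>The states that can be reached from \<open>(m, 1, m)\<close>; elsewhere the weight may be negative.\<close>

definition reachable :: "nat \<Rightarrow> nat \<Rightarrow> nat \<Rightarrow> nat \<Rightarrow> bool" where
  "reachable m p lo hi \<longleftrightarrow> 1 \<le> lo \<and> lo \<le> hi \<and> hi \<le> m \<and> (p = m \<or> lo = 1 \<and> p = hi)"

text \<open>On reachable states the weight is q^d with 1 \<le> d \<le> m or (p/m) q^p with 1 \<le> p
  \<le> m, hence between 1/m and q^m.\<close>

lemma weight_bounds:
  assumes "reachable m p lo hi"
  shows "weight m p (Suc hi - lo) \<le> (1 + 1 / m) ^ m" "1 \<le> m * weight m p (Suc hi - lo)"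
proof -
  let ?q = "1 + 1 / real m"
  have m: "m \<ge> 1" using assms by (auto simp: reachable_def)
  have pow: "1 \<le> ?q ^ d" "d \<le> m \<Longrightarrow> ?q ^ d \<le> ?q ^ m" for d
    by (simp_all add: one_le_power power_increasing)
  have "weight m p (Suc hi - lo) \<le> ?q ^ m \<and> 1 \<le> m * weight m p (Suc hi - lo)"
  proof (cases "p = m")
    case True
    have "1 * 1 \<le> m * ?q ^ (Suc hi - lo)"
      using m pow(1) by (intro mult_mono) auto
    then show ?thesis
      using True assms m pow(2) by (auto simp: weight_full reachable_def)
  next
    case False
    then have p: "lo = 1" "p = hi" "1 \<le> p" "p \<le> m"
      using assms by (auto simp: reachable_def)
    have "p / m * ?q ^ p \<le> 1 * ?q ^ m"
      using p m pow(2) by (intro mult_mono) auto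
    moreover have "1 * 1 \<le> p * ?q ^ p"
      using p pow(1) by (intro mult_mono) auto
    ultimately show ?thesis
      using p m by (simp add: weight_diagonal)
  qed
  then show "weight m p (Suc hi - lo) \<le> ?q ^ m" "1 \<le> m * weight m p (Suc hi - lo)"
    by simp_all
qed

text \<open>At length 0 the count is 1, and the bounds on the weight give both inequalities. The
  recursion has nonnegative coefficients and multiplies the weight by m + 1, so both
  persist.\<close>

lemma card_accepted_bounds:
  assumes "reachable m p lo hi"
  shows "(real m + 1) ^ n * weight m p (Suc hi - lo) \<le> (1 + 1 / m) ^ m * card (accepted m n p lo hi)"
    and "card (accepted m n p lo hi) \<le> m * ((real m + 1) ^ n * weight m p (Suc hi - lo))"
proof -
  define Q where "Q = (1 + 1 / real m) ^ m"
  have "(real m + 1) ^ n * weight m p (Suc hi - lo) \<le> Q * card (accepted m n p lo hi) \<and>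
    card (accepted m n p lo hi) \<le> m * ((real m + 1) ^ n * weight m p (Suc hi - lo))"
    using assms
  proof (induction n arbitrary: p lo hi)
    case 0
    then show ?case
      using weight_bounds[OF 0] by (simp add: accepted_0 Q_def)
  next
    case (Suc n)
    let ?W = "(\<Sum>j\<in>{lo..hi}. (real m + 1) ^ n * weight m m (Suc hi - j))
      + (\<Sum>k\<in>{1..p}. (real m + 1) ^ n * weight m k k)"
    \<comment> \<open>Transitions stay among the reachable states, so the induction hypothesis
      covers every summand.\<close>
    have U: "reachable m m j hi" if "j \<in> {lo..hi}" for j
      using that Suc.prems by (auto simp: reachable_def)
    have P: "reachable m k 1 k" if "k \<in> {1..p}" for k
      using that Suc.prems by (auto simp: reachable_def)
    have "m \<ge> 1" "lo \<le> Suc hi"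
      using Suc.prems by (auto simp: reachable_def)
    from weight_eigenvector[OF this, of p]
    have eigen: "(real m + 1) ^ Suc n * weight m p (Suc hi - lo) = ?W"
      by (simp add: sum_distrib_left[symmetric] distrib_left[symmetric] mult.assoc mult.left_commute)
    have "?W \<le> (\<Sum>j\<in>{lo..hi}. Q * card (accepted m n m j hi))
        + (\<Sum>k\<in>{1..p}. Q * card (accepted m n k 1 k))"
      using Suc.IH[OF U] Suc.IH[OF P] by (intro add_mono sum_mono) auto
    also have "\<dots> = Q * card (accepted m (Suc n) p lo hi)"
      by (simp add: card_accepted_Suc sum_distrib_left distrib_left)
    finally have lower: "?W \<le> Q * card (accepted m (Suc n) p lo hi)" .
    have "real (card (accepted m (Suc n) p lo hi))
        \<le> (\<Sum>j\<in>{lo..hi}. m * ((real m + 1) ^ n * weight m m (Suc hi - j)))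
          + (\<Sum>k\<in>{1..p}. m * ((real m + 1) ^ n * weight m k k))"
      unfolding card_accepted_Suc of_nat_add of_nat_sum
      using Suc.IH[OF U] Suc.IH[OF P] by (intro add_mono sum_mono) auto
    also have "\<dots> = m * ?W"
      by (simp only: sum_distrib_left distrib_left)
    finally show ?case
      using lower by (simp only: eigen)
  qed
  then show "(real m + 1) ^ n * weight m p (Suc hi - lo) \<le> (1 + 1 / m) ^ m * card (accepted m n p lo hi)"
    "card (accepted m n p lo hi) \<le> m * ((real m + 1) ^ n * weight m p (Suc hi - lo))"
    by (simp_all add: Q_def)
qed

section \<open>From exponential bounds to the growth rate\<close>

lemma root_tendsto_exponential:
  fixes a :: "nat \<Rightarrow> real"
  assumes "0 < c" "0 < C" "0 \<le> b"
    and "\<And>n. c * b ^ n \<le> a n" "\<And>n. a n \<le> C * b ^ n"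
  shows "(\<lambda>n. root n (a n)) \<longlonglongrightarrow> b"
proof -
  have root: "root n (K * b ^ n) = root n K * b" if "n > 0" for K n
    using that assms(3) by (simp add: real_root_mult real_root_power_cancel)
  \<comment> \<open>Constant factors disappear in the limit because \<open>root n K\<close> tends to
    1.\<close>
  have lim: "(\<lambda>n. root n K * b) \<longlonglongrightarrow> b" if "K > 0" for K
    using tendsto_mult_right[OF LIMSEQ_root_const[OF that], of b] by simp
  show ?thesis
  proof (rule tendsto_sandwich[OF _ _ lim[OF assms(1)] lim[OF assms(2)]])
    show "\<forall>\<^sub>F n in sequentially. root n c * b \<le> root n (a n)"
      using eventually_gt_at_top[of 0]
      by eventually_elim (metis root assms(4) real_root_le_iff)
    show "\<forall>\<^sub>F n in sequentially. root n (a n) \<le> root n C * b"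
      using eventually_gt_at_top[of 0]
      by eventually_elim (metis root assms(5) real_root_le_iff)
  qed
qed

theorem theorem2:
  fixes scale :: "'k::field \<Rightarrow> 'g::ab_group_add \<Rightarrow> 'g"
    and br1 br2 :: "'g \<Rightarrow> 'g \<Rightarrow> 'g"
    and f :: "nat \<Rightarrow> 'g"
    and m :: nat
  assumes "compatible_lie_brackets scale br1 br2"
    and "vector_space.dim scale (UNIV :: 'g set) = m"
    and "m \<ge> 1"
    and "ordered_basis scale m f"
  shows "has_growth_rate (U_Lie2 scale br1 br2 m f) (real m + 1)"
proof -
  define Q where "Q = (1 + 1 / real m) ^ m"
  have Q: "Q > 0"
    unfolding Q_def by (intro zero_less_power) (simp add: add_pos_nonneg)
  have words: "basis_words_of_length (U_Lie2 scale br1 br2 m f) n = accepted m n m 1 m" for n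
    by (simp add: basis_words_of_length_def U_Lie2_def Let_def L_words_eq_accepted accepted_def)
  have "reachable m m 1 m"
    using assms(3) by (simp add: reachable_def)
  \<comment> \<open>The start state has the largest weight q^m, which is \<open>Q\<close>. Hence
    \<open>Q\<close> cancels from the lower bound and leaves the constant 1 used below, while the
    upper one has \<open>m * Q\<close>.\<close>
  from card_accepted_bounds[OF this]
  have bounds: "(real m + 1) ^ n * Q \<le> Q * card (accepted m n m 1 m)"
    "card (accepted m n m 1 m) \<le> m * ((real m + 1) ^ n * Q)" for n
    using assms(3) by (simp_all add: weight_full Q_def add.commute)
  show ?thesis
    unfolding has_growth_rate_def words
  proof (rule root_tendsto_exponential)
    show "1 * (real m + 1) ^ n \<le> card (accepted m n m 1 m)" for n
      using bounds(1)[of n] Q by (simp add: mult.commute)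
    show "card (accepted m n m 1 m) \<le> (m * Q) * (real m + 1) ^ n" for n
      using bounds(2)[of n] by (simp add: mult_ac)
  qed (use Q assms(3) in auto)
qed

end
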